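(* Let $N\ge2$, let $X_1,\dots,X_N$ be Polish spaces, $\rho_i\in\mathcal P(X_i)$ Borel probability measures, and $c:X_1\times\cdots\times X_N\to[0,+\infty]$ lower semicontinuous such that, for some $\mathcal K<+\infty$ and every $i=1,\dots,N$, $\sup_{x_i\in X_i}\int_{\prod_{j\ne i}X_j}c(x_1,\dots,x_N)\,d\bigotimes_{j\neq i}\rho_j\le\mathcal K$. Let $\varepsilon>0$ and let $u_1,\dots,u_N$, with $u_i\in L^{exp,\varepsilon}_{\rho_i}$, be such that $\mathcal D^N_\varepsilon(u_1,\dots,u_N)\ge0$ and $u_N=(u_1,\dots,u_{N-1})^{c,\varepsilon}$. Then there exist functions $\tilde u_1,\dots,\tilde u_N$, with $\tilde u_i\in L^{exp,\varepsilon}_{\rho_i}$, such that: (1) $\mathcal D^N_\varepsilon(\tilde u_1,\dots,\tilde u_N)\ge0$; (2) $\int\tilde u_i\,d\rho_i\ge0$ for all $i=1,\dots,N$; (3) $-(N-1)\mathcal K\le\tilde u_i\le\mathcal K$ for all $i=1,\dots,N$.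
   Context: $L^{exp,\varepsilon}_{\rho_i}=\{u\in L^1_{\rho_i}:\int e^{u/\varepsilon}\,d\rho_i<+\infty\}$. With $\rho^N=\rho_1\otimes\cdots\otimes\rho_N$ and $e^{-\infty}=0$, $$\mathcal D^N_\varepsilon(u_1,\dots,u_N)=\sum_{i=1}^N\int_{X_i}u_i\,d\rho_i-\varepsilon\int_{X_1\times\cdots\times X_N}e^{\frac{\sum_{i=1}^N u_i(x_i)-c(x_1,\dots,x_N)}{\varepsilon}}\,d\rho^N+\varepsilon.$$ The $(c,\varepsilon)$-transform is $$(u_1,\dots,u_{N-1})^{c,\varepsilon}(x_N)=-\varepsilon\log\int_{X_1\times\cdots\times X_{N-1}}e^{\frac{\sum_{i=1}^{N-1}u_i(x_i)-c(x_1,\dots,x_N)}{\varepsilon}}\,d(\rho_1\otimes\cdots\otimes\rho_{N-1}).$$ *)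

theory Defs
  imports "HOL-Probability.Probability"
begin

text \<open>The spaces are topologies \<open>X i\<close> on subsets of one ambient type. Since that type is
  arbitrary (e.g. a disjoint union), this covers every family \<open>X 1, \<dots>, X N\<close> of unrelated spaces.
  Points of \<open>X 1 \<times> \<dots> \<times> X N\<close> are extensional functions on \<open>{1..N}\<close>.\<close>

definition polish_topology :: "'a topology \<Rightarrow> bool" where
  "polish_topology X \<longleftrightarrow> completely_metrizable_space X \<and> separable_space X"

definition borel_prob_on :: "'a topology \<Rightarrow> 'a measure \<Rightarrow> bool" where
  "borel_prob_on X \<mu> \<longleftrightarrow> prob_space \<mu> \<and> space \<mu> = topspace X \<and>
     sets \<mu> = sigma_sets (topspace X) {U. openin X U}"

definition lower_semicontinuous_map :: "'a topology \<Rightarrow> ('a \<Rightarrow> ennreal) \<Rightarrow> bool" where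
  "lower_semicontinuous_map X f \<longleftrightarrow> (\<forall>a. openin X {x \<in> topspace X. a < f x})"

definition L_exp :: "real \<Rightarrow> 'a measure \<Rightarrow> ('a \<Rightarrow> real) set" where
  "L_exp \<epsilon> \<mu> = {u. integrable \<mu> u \<and> (\<integral>\<^sup>+ x. ennreal (exp (u x / \<epsilon>)) \<partial>\<mu>) < \<infinity>}"

text \<open>\<open>exp ((s - C) / \<epsilon>)\<close> for a cost \<open>C \<in> [0, \<infinity>]\<close>, with \<open>exp (-\<infinity>) = 0\<close>.\<close>

definition exp_kernel :: "real \<Rightarrow> real \<Rightarrow> ennreal \<Rightarrow> ennreal" where
  "exp_kernel \<epsilon> s C = (if C = \<infinity> then 0 else ennreal (exp ((s - enn2real C) / \<epsilon>)))"

text \<open>The extended logarithm \<open>[0, \<infinity>] \<rightarrow> [-\<infinity>, \<infinity>]\<close>; it avoids the value \<open>ln 0 = 0\<close> of the real one.\<close>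

definition log_ext :: "ennreal \<Rightarrow> ereal" where
  "log_ext t = (if t = 0 then -\<infinity> else if t = \<infinity> then \<infinity> else ereal (ln (enn2real t)))"

definition dual_functional ::
  "nat \<Rightarrow> (nat \<Rightarrow> 'a measure) \<Rightarrow> ((nat \<Rightarrow> 'a) \<Rightarrow> ennreal) \<Rightarrow> real \<Rightarrow> (nat \<Rightarrow> 'a \<Rightarrow> real) \<Rightarrow> ereal" where
  "dual_functional N \<rho> c \<epsilon> u =
     ereal (\<Sum>i\<in>{1..N}. (\<integral>x. u i x \<partial>(\<rho> i)))
     - ereal \<epsilon> * enn2ereal
         (\<integral>\<^sup>+ x. exp_kernel \<epsilon> (\<Sum>i\<in>{1..N}. u i (x i)) (c x) \<partial>(Pi\<^sub>M {1..N} \<rho>))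
     + ereal \<epsilon>"

text \<open>The transform of \<open>(u 1, \<dots>, u (N - 1))\<close>; the update \<open>y(N := z)\<close> is the point
  \<open>(y 1, \<dots>, y (N - 1), z)\<close>.\<close>

definition c_eps_transform ::
  "nat \<Rightarrow> (nat \<Rightarrow> 'a measure) \<Rightarrow> ((nat \<Rightarrow> 'a) \<Rightarrow> ennreal) \<Rightarrow> real \<Rightarrow> (nat \<Rightarrow> 'a \<Rightarrow> real) \<Rightarrow> 'a \<Rightarrow> ereal" where
  "c_eps_transform N \<rho> c \<epsilon> u z =
     - ereal \<epsilon> * log_ext
         (\<integral>\<^sup>+ y. exp_kernel \<epsilon> (\<Sum>i\<in>{1..<N}. u i (y i)) (c (y(N := z))) \<partial>(Pi\<^sub>M {1..<N} \<rho>))"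

end

theory Submission
  imports Defs
begin

text \<open>After adding constants all potentials have nonnegative mean, and the transform hypothesis says
  that the exponential integral is \<open>1\<close>. Replacing one potential by the transform of the others keeps
  that integral equal to \<open>1\<close> and does not decrease the mean; as the other means are nonnegative,
  Jensen's inequality bounds the new potential by \<open>K\<close> from above. Once all potentials are at most
  \<open>K\<close>, a transform is at least \<open>- (N - 1) K\<close> because \<open>c \<ge> 0\<close>. So two sweeps over the
  indices suffice.\<close>

section \<open>Borel sets of finite products of Polish spaces\<close>

text \<open>Balls of radius 1/(n+1) about the points of a countable dense set form such a
  base.\<close>

lemma polish_topology_countable_base:
  assumes "polish_topology X"
  obtains \<B> where "countable \<B>" "\<And>B. B \<in> \<B> \<Longrightarrow> openin X B"
    "\<And>U x. openin X U \<Longrightarrow> x \<in> U \<Longrightarrow> \<exists>B\<in>\<B>. x \<in> B \<and> B \<subseteq> U"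
proof -
  obtain S d where Sd: "Metric_space S d" and X: "X = Metric_space.mtopology S d"
    using assms completely_metrizable_imp_metrizable_space
    unfolding polish_topology_def metrizable_space_def by blast
  interpret Metric_space S d by fact
  obtain C where C: "countable C" "C \<subseteq> S" "mtopology closure_of C = S"
    using assms unfolding polish_topology_def separable_space_def X by auto
  define \<B> where "\<B> = (\<lambda>(q, n). mball q (1 / real (Suc n))) ` (C \<times> UNIV)"
  show thesis
  proof (rule that)
    show "countable \<B>" using C(1) by (auto simp: \<B>_def)
    show "openin X B" if "B \<in> \<B>" for B
      using that by (auto simp: \<B>_def X)
    show "\<exists>B\<in>\<B>. x \<in> B \<and> B \<subseteq> U" if U: "openin X U" and x: "x \<in> U" for U x
    proof -
      obtain r where r: "r > 0" "mball x r \<subseteq> U" and xS: "x \<in> S"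
        using U x unfolding X openin_mtopology by blast
      \<comment> \<open>With radius below \<open>r / 2\<close>, a ball about a \<open>q\<close> that
        close to \<open>x\<close> contains \<open>x\<close> and stays inside
        \<open>mball x r\<close>.\<close>
      obtain n where n: "1 / real (Suc n) < r / 2"
        using r(1) nat_approx_posE[of "r / 2"] by (metis half_gt_zero)
      have "x \<in> mtopology closure_of C" using xS C by simp
      then obtain q where q: "q \<in> C" "q \<in> mball x (1 / real (Suc n))"
        unfolding metric_closure_of
        by (smt (verit) mem_Collect_eq of_nat_0_less_iff zero_less_Suc zero_less_divide_1_iff)
      have "mball q (1 / real (Suc n)) \<subseteq> mball x r"
      proof
        fix y assume "y \<in> mball q (1 / real (Suc n))"
        then show "y \<in> mball x r"
          using q n triangle[of x q y] by (auto simp del: of_nat_Suc)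
      qed
      moreover have "x \<in> mball q (1 / real (Suc n))"
        using q C by (auto simp: commute simp del: of_nat_Suc)
      ultimately show ?thesis
        using q r by (intro bexI[of _ "mball q (1 / real (Suc n))"]) (auto simp: \<B>_def simp del: of_nat_Suc)
    qed
  qed
qed

text \<open>Countable bases of the factors leave only countably many boxes to choose from, so an
  open set is a countable union of measurable boxes. This is what makes a lower semicontinuous cost
  measurable for the product sigma-algebra.\<close>

lemma openin_product_sets_PiM:
  assumes "finite I"
    and polish: "\<And>i. i \<in> I \<Longrightarrow> polish_topology (X i)"
    and borel: "\<And>i U. i \<in> I \<Longrightarrow> openin (X i) U \<Longrightarrow> U \<in> sets (M i)"
    and U: "openin (product_topology X I) U"
  shows "U \<in> sets (Pi\<^sub>M I M)"
proof -
  have "\<exists>\<B>. countable \<B> \<and> (\<forall>B\<in>\<B>. openin (X i) B) \<and>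
      (\<forall>V x. openin (X i) V \<longrightarrow> x \<in> V \<longrightarrow> (\<exists>B\<in>\<B>. x \<in> B \<and> B \<subseteq> V))" if "i \<in> I" for i
    using polish_topology_countable_base[OF polish[OF that]] by metis
  then obtain \<B> where \<B>: "\<And>i. i \<in> I \<Longrightarrow> countable (\<B> i)"
    "\<And>i B. i \<in> I \<Longrightarrow> B \<in> \<B> i \<Longrightarrow> openin (X i) B"
    "\<And>i V x. i \<in> I \<Longrightarrow> openin (X i) V \<Longrightarrow> x \<in> V \<Longrightarrow> \<exists>B\<in>\<B> i. x \<in> B \<and> B \<subseteq> V"
    by metis
  define \<C> where "\<C> = {E \<in> Pi\<^sub>E I \<B>. Pi\<^sub>E I E \<subseteq> U}"
  have "countable (Pi\<^sub>E I \<B>)"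
    using \<open>finite I\<close> \<B>(1) by (rule countable_PiE)
  then have "countable \<C>"
    by (rule countable_subset[rotated]) (auto simp: \<C>_def)
  moreover have "Pi\<^sub>E I E \<in> sets (Pi\<^sub>M I M)" if "E \<in> \<C>" for E
    using that \<B>(2) borel \<open>finite I\<close> by (intro sets_PiM_I_finite) (auto simp: \<C>_def PiE_iff)
  ultimately have "(\<Union>E\<in>\<C>. Pi\<^sub>E I E) \<in> sets (Pi\<^sub>M I M)"
    by (intro sets.countable_UN') auto
  moreover have "(\<Union>E\<in>\<C>. Pi\<^sub>E I E) = U"
  proof (intro subset_antisym subsetI)
    fix x assume "x \<in> U"
    then obtain V where V: "\<And>i. i \<in> I \<Longrightarrow> openin (X i) (V i)" "x \<in> Pi\<^sub>E I V" "Pi\<^sub>E I V \<subseteq> U"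
      using U unfolding openin_product_topology_alt by metis
    have "\<exists>B. B \<in> \<B> i \<and> x i \<in> B \<and> B \<subseteq> V i" if "i \<in> I" for i
      using \<B>(3)[OF that V(1)[OF that], of "x i"] V(2) that by auto
    then obtain E where E: "\<And>i. i \<in> I \<Longrightarrow> E i \<in> \<B> i \<and> x i \<in> E i \<and> E i \<subseteq> V i"
      by metis
    \<comment> \<open>Only extensional families of sides are counted, hence
      \<open>restrict E I\<close> in place of \<open>E\<close>.\<close>
    have "Pi\<^sub>E I (restrict E I) \<subseteq> Pi\<^sub>E I V"
      using E by (intro PiE_mono) auto
    then have "restrict E I \<in> \<C>" "x \<in> Pi\<^sub>E I (restrict E I)"
      using E V by (auto simp: \<C>_def PiE_iff)
    then show "x \<in> (\<Union>E\<in>\<C>. Pi\<^sub>E I E)" by blast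
  qed (auto simp: \<C>_def)
  ultimately show ?thesis by simp
qed

section \<open>The exponential kernel and a comparison of integrals\<close>

lemma exp_kernel_add:
  "exp_kernel \<epsilon> (s + t) C = ennreal (exp (s / \<epsilon>)) * exp_kernel \<epsilon> t C"
  by (simp add: exp_kernel_def flip: ennreal_mult' exp_add)
     (simp add: diff_divide_distrib add_divide_distrib algebra_simps)

lemma exp_kernel_le:
  assumes "0 < \<epsilon>"
  shows "exp_kernel \<epsilon> s C \<le> ennreal (exp (s / \<epsilon>))"
  using assms by (auto simp: exp_kernel_def intro!: ennreal_leI divide_right_mono)

lemma measurable_exp_kernel [measurable]:
  assumes [measurable]: "f \<in> borel_measurable M" "g \<in> borel_measurable M"
  shows "(\<lambda>x. exp_kernel \<epsilon> (f x) (g x)) \<in> borel_measurable M"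
  unfolding exp_kernel_def by measurable

text \<open>Lets Jensen's inequality be used before the exponential is known to be integrable: the
  integral of \<open>f\<close> is raised to that of its positive part and then compared in
  [0, \<infinity>].\<close>

lemma integral_le_nn_integral:
  assumes "integrable M f" "\<And>x. x \<in> space M \<Longrightarrow> f x \<le> g x" "\<And>x. x \<in> space M \<Longrightarrow> 0 \<le> g x"
  shows "ennreal (integral\<^sup>L M f) \<le> (\<integral>\<^sup>+ x. ennreal (g x) \<partial>M)"
proof -
  have "ennreal (integral\<^sup>L M f) \<le> ennreal (\<integral>x. max 0 (f x) \<partial>M)"
    using assms(1) by (intro ennreal_leI integral_mono) auto
  also have "\<dots> = (\<integral>\<^sup>+ x. ennreal (max 0 (f x)) \<partial>M)"
    using assms(1) by (intro nn_integral_eq_integral[symmetric]) auto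
  also have "\<dots> \<le> (\<integral>\<^sup>+ x. ennreal (g x) \<partial>M)"
    using assms(2,3) by (intro nn_integral_mono ennreal_leI) auto
  finally show ?thesis .
qed

section \<open>Coordinate updates on a finite product\<close>

text \<open>An arbitrary finite index set puts all coordinates on the same footing, so that a
  transform can be taken in any of them. Of the topology only the measurability of the cost is
  left.\<close>

locale entropic_dual = product_prob_space M I
  for M :: "'i \<Rightarrow> 'a measure" and I :: "'i set" +
  fixes c :: "('i \<Rightarrow> 'a) \<Rightarrow> ennreal" and K \<epsilon> :: real
  assumes finite_I: "finite I"
    and measurable_cost [measurable]: "c \<in> borel_measurable (Pi\<^sub>M I M)"
    and K_nonneg: "0 \<le> K"
    and eps_pos: "0 < \<epsilon>"
    and cost_bound: "\<And>i z. i \<in> I \<Longrightarrow> z \<in> space (M i) \<Longrightarrow>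
      (\<integral>\<^sup>+ y. c (y(i := z)) \<partial>(Pi\<^sub>M (I - {i}) M)) \<le> ennreal K"
begin

definition partition_fun :: "('i \<Rightarrow> 'a \<Rightarrow> real) \<Rightarrow> ennreal" where
  "partition_fun u = (\<integral>\<^sup>+ x. exp_kernel \<epsilon> (\<Sum>i\<in>I. u i (x i)) (c x) \<partial>(Pi\<^sub>M I M))"

text \<open>Multiplied by \<open>exp (u i z / \<epsilon>)\<close>, this is the density with respect
  to \<open>M i\<close> of the \<open>i\<close>-th marginal of the Gibbs measure whose total mass is
  \<open>partition_fun u\<close>.\<close>

definition marginal_fun :: "('i \<Rightarrow> 'a \<Rightarrow> real) \<Rightarrow> 'i \<Rightarrow> 'a \<Rightarrow> ennreal" where
  "marginal_fun u i z =
    (\<integral>\<^sup>+ y. exp_kernel \<epsilon> (\<Sum>j\<in>I - {i}. u j (y j)) (c (y(i := z))) \<partial>(Pi\<^sub>M (I - {i}) M))"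

text \<open>The value \<open>K\<close> replaces \<open>-\<infinity>\<close>; if \<open>u\<close> is admissible this only happens on a
  null set.\<close>

definition transform :: "('i \<Rightarrow> 'a \<Rightarrow> real) \<Rightarrow> 'i \<Rightarrow> 'a \<Rightarrow> real" where
  "transform u i z =
    (if marginal_fun u i z = \<infinity> then K else - \<epsilon> * ln (enn2real (marginal_fun u i z)))"

text \<open>The invariant of the sweeps. It makes the dual functional nonnegative: the means are
  nonnegative, and so is \<open>\<epsilon> - \<epsilon> * partition_fun u\<close>.\<close>

definition admissible :: "('i \<Rightarrow> 'a \<Rightarrow> real) \<Rightarrow> bool" where
  "admissible u \<longleftrightarrow>
    (\<forall>i\<in>I. integrable (M i) (u i) \<and> 0 \<le> integral\<^sup>L (M i) (u i)) \<and> partition_fun u \<le> 1"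

lemma sum_fun_upd_remove:
  assumes "i \<in> I"
  shows "(\<Sum>j\<in>I. u j ((y(i := z)) j)) = u i z + (\<Sum>j\<in>I - {i}. u j (y j))"
proof -
  have "(\<Sum>j\<in>I - {i}. u j ((y(i := z)) j)) = (\<Sum>j\<in>I - {i}. u j (y j))"
    by (intro sum.cong) auto
  then show ?thesis by (simp add: sum.remove[OF finite_I assms])
qed

lemma measurable_sum_component:
  fixes u :: "'i \<Rightarrow> 'a \<Rightarrow> real"
  assumes "\<And>j. j \<in> J \<Longrightarrow> u j \<in> borel_measurable (M j)"
  shows "(\<lambda>x. \<Sum>j\<in>J. u j (x j)) \<in> borel_measurable (Pi\<^sub>M J M)"
proof (rule borel_measurable_sum)
  fix j assume "j \<in> J"
  then show "(\<lambda>x. u j (x j)) \<in> borel_measurable (Pi\<^sub>M J M)"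
    using measurable_compose[OF measurable_component_singleton[of j J M] assms[of j]] by simp
qed

lemma measurable_cost_section:
  assumes "i \<in> I"
  shows "(\<lambda>(z, y). c (y(i := z))) \<in> borel_measurable (M i \<Otimes>\<^sub>M Pi\<^sub>M (I - {i}) M)"
proof -
  have "(\<lambda>x. (snd x)(i := fst x)) \<in> measurable (M i \<Otimes>\<^sub>M Pi\<^sub>M (I - {i}) M) (Pi\<^sub>M I M)"
    using assms by (intro measurable_fun_upd[of I "I - {i}" i]) auto
  from measurable_compose[OF this measurable_cost] show ?thesis
    by (simp add: case_prod_unfold)
qed

lemma measurable_marginal_fun:
  assumes i: "i \<in> I" and u: "\<And>j. j \<in> I \<Longrightarrow> u j \<in> borel_measurable (M j)"
  shows "marginal_fun u i \<in> borel_measurable (M i)"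
proof -
  interpret J: prob_space "Pi\<^sub>M (I - {i}) M"
    using prob_space by (rule prob_space_PiM)
  have [measurable]: "(\<lambda>x. c ((snd x)(i := fst x))) \<in> borel_measurable (M i \<Otimes>\<^sub>M Pi\<^sub>M (I - {i}) M)"
    using measurable_cost_section[OF i] by (simp add: case_prod_unfold)
  have [measurable]: "(\<lambda>y. \<Sum>j\<in>I - {i}. u j (y j)) \<in> borel_measurable (Pi\<^sub>M (I - {i}) M)"
    using u by (intro measurable_sum_component) auto
  show ?thesis unfolding marginal_fun_def
    by (intro J.borel_measurable_nn_integral) (simp add: case_prod_unfold)
qed

text \<open>Tonelli in coordinate \<open>i\<close>, after which the factor depending on
  \<open>z\<close> alone leaves the inner integral. As \<open>i\<close> is arbitrary, one partition
  function controls every marginal.\<close>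

lemma partition_fun_eq:
  assumes i: "i \<in> I" and u: "\<And>j. j \<in> I \<Longrightarrow> u j \<in> borel_measurable (M j)"
  shows "partition_fun u = (\<integral>\<^sup>+ z. ennreal (exp (u i z / \<epsilon>)) * marginal_fun u i z \<partial>(M i))"
proof -
  have I: "insert i (I - {i}) = I" using i by auto
  have [measurable]: "(\<lambda>x. \<Sum>j\<in>I. u j (x j)) \<in> borel_measurable (Pi\<^sub>M I M)"
    using u by (intro measurable_sum_component) auto
  have "partition_fun u = (\<integral>\<^sup>+ z. (\<integral>\<^sup>+ y. exp_kernel \<epsilon> (\<Sum>j\<in>I. u j ((y(i := z)) j)) (c (y(i := z)))
      \<partial>(Pi\<^sub>M (I - {i}) M)) \<partial>(M i))"
    unfolding partition_fun_def
    by (rule product_nn_integral_insert_rev[of "I - {i}" i, unfolded I]) (use finite_I in auto)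
  also have "\<dots> = (\<integral>\<^sup>+ z. ennreal (exp (u i z / \<epsilon>)) * marginal_fun u i z \<partial>(M i))"
  proof (intro nn_integral_cong)
    fix z assume z: "z \<in> space (M i)"
    have [measurable]: "(\<lambda>y. c (y(i := z))) \<in> borel_measurable (Pi\<^sub>M (I - {i}) M)"
      using measurable_Pair2[OF measurable_cost_section[OF i] z] by simp
    have [measurable]: "(\<lambda>y. \<Sum>j\<in>I - {i}. u j (y j)) \<in> borel_measurable (Pi\<^sub>M (I - {i}) M)"
      using u by (intro measurable_sum_component) auto
    show "(\<integral>\<^sup>+ y. exp_kernel \<epsilon> (\<Sum>j\<in>I. u j ((y(i := z)) j)) (c (y(i := z))) \<partial>(Pi\<^sub>M (I - {i}) M))
      = ennreal (exp (u i z / \<epsilon>)) * marginal_fun u i z"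
      unfolding sum_fun_upd_remove[OF i] exp_kernel_add marginal_fun_def
      by (rule nn_integral_cmult) simp
  qed
  finally show ?thesis .
qed

text \<open>Jensen's inequality for the exponential, via its tangent at \<open>-K / \<epsilon>\<close>.\<close>

lemma marginal_fun_ge:
  assumes i: "i \<in> I" and u: "\<And>j. j \<in> I \<Longrightarrow> integrable (M j) (u j)"
    and mean: "\<And>j. j \<in> I \<Longrightarrow> 0 \<le> integral\<^sup>L (M j) (u j)"
    and z: "z \<in> space (M i)"
  shows "ennreal (exp (- K / \<epsilon>)) \<le> marginal_fun u i z"
proof -
  interpret J: prob_space "Pi\<^sub>M (I - {i}) M"
    using prob_space by (rule prob_space_PiM)
  define C where "C y = c (y(i := z))" for y
  define S where "S y = (\<Sum>j\<in>I - {i}. u j (y j))" for y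
  have C_meas [measurable]: "C \<in> borel_measurable (Pi\<^sub>M (I - {i}) M)"
    using measurable_Pair2[OF measurable_cost_section[OF i] z] by (simp add: C_def[abs_def])
  have C_le: "(\<integral>\<^sup>+ y. C y \<partial>(Pi\<^sub>M (I - {i}) M)) \<le> ennreal K"
    using cost_bound[OF i z] by (simp add: C_def[abs_def])
  \<comment> \<open>The finite mean of the cost makes infinite cost a null event, so
    \<open>enn2real\<close>, which sends \<infinity> to 0, changes no integral.\<close>
  have C_fin: "AE y in Pi\<^sub>M (I - {i}) M. C y \<noteq> \<infinity>"
    using C_le by (intro nn_integral_PInf_AE) (auto simp: top_unique)
  have eq: "(\<integral>\<^sup>+ y. ennreal (enn2real (C y)) \<partial>(Pi\<^sub>M (I - {i}) M)) = (\<integral>\<^sup>+ y. C y \<partial>(Pi\<^sub>M (I - {i}) M))"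
    using C_fin by (intro nn_integral_cong_AE) (auto simp: less_top)
  have C_int: "integrable (Pi\<^sub>M (I - {i}) M) (\<lambda>y. enn2real (C y))"
    using C_le eq by (intro integrableI_nonneg) (auto simp: le_less_trans[OF _ ennreal_less_top])
  have C_int_le: "(\<integral>y. enn2real (C y) \<partial>(Pi\<^sub>M (I - {i}) M)) \<le> K"
    using nn_integral_eq_integral[OF C_int] eq C_le K_nonneg by simp
  \<comment> \<open>Coordinate \<open>j\<close> has law \<open>M j\<close> under the product
    measure, so the means of the potentials carry over.\<close>
  have comp: "integrable (Pi\<^sub>M (I - {i}) M) (\<lambda>y. u j (y j)) \<and>
      (\<integral>y. u j (y j) \<partial>(Pi\<^sub>M (I - {i}) M)) = integral\<^sup>L (M j) (u j)" if "j \<in> I - {i}" for j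
  proof -
    have d: "distr (Pi\<^sub>M (I - {i}) M) (M j) (\<lambda>y. y j) = M j"
      using prob_space that by (rule distr_PiM_component)
    have m: "(\<lambda>y. y j) \<in> measurable (Pi\<^sub>M (I - {i}) M) (M j)"
      using that by measurable
    have uj: "u j \<in> borel_measurable (M j)" "integrable (M j) (u j)" using u that by auto
    show ?thesis
      using integrable_distr_eq[OF m uj(1)] integral_distr[OF m uj(1)] uj d by simp
  qed
  have S_int: "integrable (Pi\<^sub>M (I - {i}) M) S" and S_ge: "0 \<le> integral\<^sup>L (Pi\<^sub>M (I - {i}) M) S"
    unfolding S_def using comp mean
    by (auto simp: Bochner_Integration.integral_sum
        intro!: sum_nonneg Bochner_Integration.integrable_sum)
  \<comment> \<open>The exponent \<open>(S y - enn2real (C y)) / \<epsilon>\<close> has mean at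
    least \<open>- K / \<epsilon>\<close>, so the tangent to exp at that point has mean at least
    \<open>exp (- K / \<epsilon>)\<close>.\<close>
  define t where "t y = exp (- K / \<epsilon>) * (1 + (S y - enn2real (C y) + K) / \<epsilon>)" for y
  have t_int: "integrable (Pi\<^sub>M (I - {i}) M) t"
    unfolding t_def using S_int C_int by (intro integrable_mult_right integrable_add integrable_divide) auto
  have "integral\<^sup>L (Pi\<^sub>M (I - {i}) M) t = exp (- K / \<epsilon>) *
      (1 + (integral\<^sup>L (Pi\<^sub>M (I - {i}) M) S - (\<integral>y. enn2real (C y) \<partial>(Pi\<^sub>M (I - {i}) M)) + K) / \<epsilon>)"
    unfolding t_def using S_int C_int by (simp add: J.prob_space)
  also have "\<dots> \<ge> exp (- K / \<epsilon>) * 1"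
    using S_ge C_int_le eps_pos by (intro mult_left_mono) auto
  finally have "ennreal (exp (- K / \<epsilon>)) \<le> ennreal (integral\<^sup>L (Pi\<^sub>M (I - {i}) M) t)"
    by (intro ennreal_leI) simp
  also have "\<dots> \<le> (\<integral>\<^sup>+ y. ennreal (exp ((S y - enn2real (C y)) / \<epsilon>)) \<partial>(Pi\<^sub>M (I - {i}) M))"
  proof (rule integral_le_nn_integral[OF t_int])
    fix y
    have "t y \<le> exp (- K / \<epsilon>) * exp ((S y - enn2real (C y) + K) / \<epsilon>)"
      unfolding t_def by (intro mult_left_mono exp_ge_add_one_self) auto
    also have "\<dots> = exp ((S y - enn2real (C y)) / \<epsilon>)"
      by (simp add: add_divide_distrib diff_divide_distrib flip: exp_add)
    finally show "t y \<le> exp ((S y - enn2real (C y)) / \<epsilon>)" .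
  qed auto
  also have "\<dots> = marginal_fun u i z"
    unfolding marginal_fun_def using C_fin
    by (intro nn_integral_cong_AE) (auto simp: exp_kernel_def C_def S_def)
  finally show ?thesis .
qed

text \<open>Dropping the nonnegative cost leaves \<open>card I - 1\<close> potentials, each at most
  \<open>K\<close>, and the integral is over a probability measure.\<close>

lemma marginal_fun_le:
  assumes le: "\<And>j x. j \<in> I \<Longrightarrow> x \<in> space (M j) \<Longrightarrow> u j x \<le> K" and i: "i \<in> I"
  shows "marginal_fun u i z \<le> ennreal (exp ((real (card I) - 1) * K / \<epsilon>))"
proof -
  interpret J: prob_space "Pi\<^sub>M (I - {i}) M"
    using prob_space by (rule prob_space_PiM)
  have "marginal_fun u i z \<le> (\<integral>\<^sup>+ y. ennreal (exp ((real (card I) - 1) * K / \<epsilon>)) \<partial>(Pi\<^sub>M (I - {i}) M))"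
    unfolding marginal_fun_def
  proof (intro nn_integral_mono)
    fix y assume y: "y \<in> space (Pi\<^sub>M (I - {i}) M)"
    have "(\<Sum>j\<in>I - {i}. u j (y j)) \<le> real (card (I - {i})) * K"
      using y by (intro sum_bounded_above le) (auto simp: space_PiM)
    also have "real (card (I - {i})) = real (card I) - 1"
      using i finite_I by (metis card_gt_0_iff card_Diff_singleton empty_iff of_nat_1 of_nat_diff
          Suc_leI One_nat_def)
    finally have "exp ((\<Sum>j\<in>I - {i}. u j (y j)) / \<epsilon>) \<le> exp ((real (card I) - 1) * K / \<epsilon>)"
      using eps_pos by (simp add: divide_right_mono)
    then show "exp_kernel \<epsilon> (\<Sum>j\<in>I - {i}. u j (y j)) (c (y(i := z)))
        \<le> ennreal (exp ((real (card I) - 1) * K / \<epsilon>))"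
      using exp_kernel_le[OF eps_pos] by (meson ennreal_leI order_trans)
  qed
  then show ?thesis by (simp add: J.emeasure_space_1)
qed

text \<open>Both exclusions matter: at \<infinity> \<open>transform\<close> takes its default value,
  and at 0 the real \<open>ln 0 = 0\<close> makes it 0 instead of \<infinity>.\<close>

lemma exp_transform:
  assumes "marginal_fun u i z \<noteq> \<infinity>" "marginal_fun u i z \<noteq> 0"
  shows "ennreal (exp (- transform u i z / \<epsilon>)) = marginal_fun u i z"
proof -
  have "0 < enn2real (marginal_fun u i z)"
    using assms by (simp add: enn2real_positive_iff less_top zero_less_iff_neq_zero)
  then show ?thesis
    using assms eps_pos by (simp add: transform_def less_top)
qed

text \<open>The default value \<open>K\<close> itself satisfies the bound, which therefore holds at
  every point and not just almost everywhere.\<close>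

lemma transform_le:
  assumes "ennreal (exp (- K / \<epsilon>)) \<le> marginal_fun u i z"
  shows "transform u i z \<le> K"
proof (cases "marginal_fun u i z = \<infinity>")
  case False
  have "marginal_fun u i z \<noteq> 0" using assms by auto
  then have "exp (- K / \<epsilon>) \<le> exp (- transform u i z / \<epsilon>)"
    using exp_transform[OF False] assms by (metis ennreal_le_iff exp_ge_zero)
  then show ?thesis using eps_pos by (simp add: divide_le_cancel del: minus_divide_left)
qed (simp add: transform_def)

lemma transform_ge:
  assumes "marginal_fun u i z \<noteq> 0" "marginal_fun u i z \<le> ennreal (exp (b / \<epsilon>))"
  shows "- b \<le> transform u i z"
proof -
  have "marginal_fun u i z \<noteq> \<infinity>" using assms(2) by (auto simp: top_unique)
  then have "exp (- transform u i z / \<epsilon>) \<le> exp (b / \<epsilon>)"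
    using exp_transform[of u i z] assms by (metis ennreal_le_iff exp_ge_zero)
  then show ?thesis using eps_pos by (simp add: divide_le_cancel minus_le_iff flip: divide_minus_left)
qed

text \<open>Block coordinate ascent: integrating \<open>exp s \<ge> 1 + s\<close> with \<open>s = (u i - transform u i) / \<epsilon>\<close>
  shows that the mean of the \<open>i\<close>-th potential does not decrease.\<close>

lemma admissible_transform:
  assumes adm: "admissible u" and i: "i \<in> I"
  shows "admissible (u(i := transform u i))"
proof -
  have u: "integrable (M j) (u j)" "0 \<le> integral\<^sup>L (M j) (u j)" "u j \<in> borel_measurable (M j)"
    if "j \<in> I" for j
    using adm that unfolding admissible_def by auto
  define w where "w = transform u i"
  have F_meas [measurable]: "marginal_fun u i \<in> borel_measurable (M i)"
    using i u by (intro measurable_marginal_fun) auto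
  have ui_meas [measurable]: "u i \<in> borel_measurable (M i)" using u i by auto
  have w_meas [measurable]: "w \<in> borel_measurable (M i)"
    unfolding w_def transform_def[abs_def] by measurable
  have F_ge: "ennreal (exp (- K / \<epsilon>)) \<le> marginal_fun u i z" if "z \<in> space (M i)" for z
    using i u that by (intro marginal_fun_ge) auto
  have F_pos: "marginal_fun u i z \<noteq> 0" if "z \<in> space (M i)" for z
    using F_ge[OF that] by auto
  have part: "(\<integral>\<^sup>+ z. ennreal (exp (u i z / \<epsilon>)) * marginal_fun u i z \<partial>(M i)) \<le> 1"
    using adm partition_fun_eq[of i u] i u unfolding admissible_def by auto
  \<comment> \<open>The product has a finite integral and its exponential factor is positive, so the
    marginal is finite almost everywhere.\<close>
  have "AE z in M i. ennreal (exp (u i z / \<epsilon>)) * marginal_fun u i z \<noteq> \<infinity>"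
    using part by (intro nn_integral_PInf_AE) (auto simp: top_unique)
  then have F_fin: "AE z in M i. marginal_fun u i z \<noteq> \<infinity>"
    by eventually_elim (auto simp: ennreal_mult_top)
  have F_eq: "AE z in M i. marginal_fun u i z = ennreal (exp (- w z / \<epsilon>))"
    using F_fin AE_space by eventually_elim (metis exp_transform F_pos w_def)
  \<comment> \<open>Almost everywhere \<open>g\<close> is the integrand of
    \<open>partition_fun_eq\<close>, so its integral is at most 1.\<close>
  define g where "g z = exp ((u i z - w z) / \<epsilon>)" for z
  have g_nn: "(\<integral>\<^sup>+ z. ennreal (g z) \<partial>(M i)) \<le> 1"
  proof -
    have "(\<integral>\<^sup>+ z. ennreal (g z) \<partial>(M i)) =
        (\<integral>\<^sup>+ z. ennreal (exp (u i z / \<epsilon>)) * marginal_fun u i z \<partial>(M i))"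
      using F_eq
      by (intro nn_integral_cong_AE, eventually_elim)
         (simp add: g_def diff_divide_distrib flip: ennreal_mult' exp_add)
    then show ?thesis using part by simp
  qed
  have g_int: "integrable (M i) g"
    unfolding g_def using g_nn[unfolded g_def]
    by (intro integrableI_nonneg) (auto simp: le_less_trans[OF _ ennreal_one_less_top])
  have g_le: "integral\<^sup>L (M i) g \<le> 1"
    using nn_integral_eq_integral[OF g_int] g_nn by (simp add: g_def)
  have w_le: "w z \<le> K" if "z \<in> space (M i)" for z
    unfolding w_def using F_ge[OF that] by (rule transform_le)
  have w_ge: "u i z + \<epsilon> - \<epsilon> * g z \<le> w z" for z
  proof -
    have "\<epsilon> * (1 + (u i z - w z) / \<epsilon>) \<le> \<epsilon> * g z"
      unfolding g_def using eps_pos by (intro mult_left_mono exp_ge_add_one_self) auto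
    then show ?thesis using eps_pos by (simp add: distrib_left)
  qed
  have l_int: "integrable (M i) (\<lambda>z. u i z + \<epsilon> - \<epsilon> * g z)"
    using g_int u i by auto
  \<comment> \<open>\<open>w\<close> lies between the integrable minorant of \<open>w_ge\<close> and
    the constant \<open>K\<close>.\<close>
  have w_int: "integrable (M i) w"
  proof (rule Bochner_Integration.integrable_bound)
    show "integrable (M i) (\<lambda>z. \<bar>u i z + \<epsilon> - \<epsilon> * g z\<bar> + K)"
      using l_int by auto
    show "AE z in M i. norm (w z) \<le> norm (\<bar>u i z + \<epsilon> - \<epsilon> * g z\<bar> + K)"
    proof (rule AE_I2)
      fix z assume "z \<in> space (M i)"
      from w_le[OF this] w_ge[of z] K_nonneg
      show "norm (w z) \<le> norm (\<bar>u i z + \<epsilon> - \<epsilon> * g z\<bar> + K)" by auto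
    qed
  qed simp
  have "0 \<le> integral\<^sup>L (M i) (u i) + \<epsilon> - \<epsilon> * integral\<^sup>L (M i) g"
    using u(2)[OF i] mult_left_mono[OF g_le less_imp_le[OF eps_pos]] by linarith
  also have "\<dots> = (\<integral>z. u i z + \<epsilon> - \<epsilon> * g z \<partial>(M i))"
    using g_int u(1)[OF i] by (simp add: M.prob_space)
  also have "\<dots> \<le> integral\<^sup>L (M i) w"
    using l_int w_int w_ge by (intro integral_mono) auto
  finally have w_mean: "0 \<le> integral\<^sup>L (M i) w" .
  \<comment> \<open>The marginal in coordinate \<open>i\<close> does not see \<open>u i\<close>.
    Hence the new integrand is \<open>exp (w z / \<epsilon>)\<close> times
    \<open>exp (- w z / \<epsilon>)\<close>, that is 1, almost everywhere.\<close>
  have "marginal_fun (u(i := w)) i = marginal_fun u i"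
    by (intro ext) (simp add: marginal_fun_def cong: sum.cong_simp)
  then have "partition_fun (u(i := w)) =
      (\<integral>\<^sup>+ z. ennreal (exp (w z / \<epsilon>)) * marginal_fun u i z \<partial>(M i))"
    using partition_fun_eq[of i "u(i := w)"] i u by simp
  also have "\<dots> = (\<integral>\<^sup>+ z. 1 \<partial>(M i))"
    using F_eq by (intro nn_integral_cong_AE, eventually_elim)
      (simp flip: ennreal_mult' exp_add)
  also have "\<dots> = 1" by (simp add: M.emeasure_space_1)
  finally have "partition_fun (u(i := w)) = 1" .
  then show ?thesis
    unfolding admissible_def w_def[symmetric] using u w_int w_mean by auto
qed

section \<open>The two sweeps over the indices\<close>

lemma admissible_transform_le:
  assumes "admissible u" "i \<in> I" "z \<in> space (M i)"
  shows "transform u i z \<le> K"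
  using assms by (intro transform_le marginal_fun_ge) (auto simp: admissible_def)

lemma admissible_transform_ge:
  assumes "admissible u" "i \<in> I" "z \<in> space (M i)"
    and "\<And>j x. j \<in> I \<Longrightarrow> x \<in> space (M j) \<Longrightarrow> u j x \<le> K"
  shows "- ((real (card I) - 1) * K) \<le> transform u i z"
proof (rule transform_ge)
  have "ennreal (exp (- K / \<epsilon>)) \<le> marginal_fun u i z"
    using assms by (intro marginal_fun_ge) (auto simp: admissible_def)
  then show "marginal_fun u i z \<noteq> 0" by auto
qed (use assms in \<open>intro marginal_fun_le; auto\<close>)

text \<open>First sweep, one index at a time: the upper bound on a new potential uses only
  admissibility, and an update leaves the other potentials alone.\<close>

lemma admissible_bounded_above:
  assumes "admissible u" "J \<subseteq> I"
  shows "\<exists>v. admissible v \<and> (\<forall>j\<in>J. \<forall>x\<in>space (M j). v j x \<le> K)"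
  using finite_subset[OF assms(2) finite_I] assms(2)
proof (induction J)
  case empty
  then show ?case using assms by auto
next
  case (insert i J)
  then obtain v where "admissible v" "\<forall>j\<in>J. \<forall>x\<in>space (M j). v j x \<le> K" by auto
  then have "admissible (v(i := transform v i))"
    "\<forall>j\<in>insert i J. \<forall>x\<in>space (M j). (v(i := transform v i)) j x \<le> K"
    using insert.prems admissible_transform[of v i] admissible_transform_le[of v i] by simp_all
  then show ?case by blast
qed

text \<open>Second sweep. The upper bounds on all potentials are carried through the induction
  because each new lower bound relies on them; updates preserve them.\<close>

lemma admissible_bounded:
  assumes "admissible u" "\<And>j x. j \<in> I \<Longrightarrow> x \<in> space (M j) \<Longrightarrow> u j x \<le> K" "J \<subseteq> I"
  shows "\<exists>v. admissible v \<and> (\<forall>j\<in>I. \<forall>x\<in>space (M j). v j x \<le> K) \<and>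
    (\<forall>j\<in>J. \<forall>x\<in>space (M j). - ((real (card I) - 1) * K) \<le> v j x)"
  using finite_subset[OF assms(3) finite_I] assms(3)
proof (induction J)
  case empty
  then show ?case using assms by auto
next
  case (insert i J)
  then obtain v where "admissible v" "\<forall>j\<in>I. \<forall>x\<in>space (M j). v j x \<le> K"
    "\<forall>j\<in>J. \<forall>x\<in>space (M j). - ((real (card I) - 1) * K) \<le> v j x" by auto
  then have "admissible (v(i := transform v i))"
    "\<forall>j\<in>I. \<forall>x\<in>space (M j). (v(i := transform v i)) j x \<le> K"
    "\<forall>j\<in>insert i J. \<forall>x\<in>space (M j). - ((real (card I) - 1) * K) \<le> (v(i := transform v i)) j x"
    using insert.prems admissible_transform[of v i] admissible_transform_le[of v i]
      admissible_transform_ge[of v i] by simp_all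
  then show ?case by blast
qed

text \<open>Adding constants of total \<open>0\<close> to the potentials changes neither the partition function
  nor the sum of the means, so the means can be made equal.\<close>

lemma admissible_shift:
  assumes "I \<noteq> {}" and u: "\<And>i. i \<in> I \<Longrightarrow> integrable (M i) (u i)"
    and sum: "0 \<le> (\<Sum>i\<in>I. integral\<^sup>L (M i) (u i))" and part: "partition_fun u \<le> 1"
  shows "\<exists>v. admissible v"
proof -
  define S where "S = (\<Sum>i\<in>I. integral\<^sup>L (M i) (u i))"
  define v where "v i x = u i x + (S / real (card I) - integral\<^sup>L (M i) (u i))" for i x
  have card: "0 < card I" using assms(1) finite_I by (simp add: card_gt_0_iff)
  have "(\<Sum>i\<in>I. v i (x i)) = (\<Sum>i\<in>I. u i (x i))" for x
    using card by (simp add: v_def sum.distrib sum_subtractf S_def)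
  then have "partition_fun v \<le> 1" using part by (simp add: partition_fun_def)
  moreover have "integrable (M i) (v i) \<and> integral\<^sup>L (M i) (v i) = S / real (card I)" if "i \<in> I" for i
    unfolding v_def using u[OF that] by (simp add: M.prob_space)
  ultimately show ?thesis
    using sum card unfolding admissible_def S_def by (intro exI[of _ v]) auto
qed

end

section \<open>The dual problem on Polish spaces\<close>

theorem proposition5p6:
  fixes N :: nat and X :: "nat \<Rightarrow> 'a topology" and \<rho> :: "nat \<Rightarrow> 'a measure"
    and c :: "(nat \<Rightarrow> 'a) \<Rightarrow> ennreal" and K \<epsilon> :: real and u :: "nat \<Rightarrow> 'a \<Rightarrow> real"
  assumes "2 \<le> N"
    and "\<And>i. i \<in> {1..N} \<Longrightarrow> polish_topology (X i)"
    and "\<And>i. i \<in> {1..N} \<Longrightarrow> borel_prob_on (X i) (\<rho> i)"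
    and "lower_semicontinuous_map (product_topology X {1..N}) c"
    and "\<And>i. i \<in> {1..N} \<Longrightarrow>
           enn2ereal (SUP z\<in>topspace (X i). \<integral>\<^sup>+ y. c (y(i := z)) \<partial>(Pi\<^sub>M ({1..N} - {i}) \<rho>)) \<le> ereal K"
    and "0 < \<epsilon>"
    and "\<And>i. i \<in> {1..N} \<Longrightarrow> u i \<in> L_exp \<epsilon> (\<rho> i)"
    and "0 \<le> dual_functional N \<rho> c \<epsilon> u"
    and "AE z in \<rho> N. ereal (u N z) = c_eps_transform N \<rho> c \<epsilon> u z"
  shows "\<exists>v :: nat \<Rightarrow> 'a \<Rightarrow> real.
           (\<forall>i\<in>{1..N}. v i \<in> L_exp \<epsilon> (\<rho> i)) \<and>
           0 \<le> dual_functional N \<rho> c \<epsilon> v \<and>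
           (\<forall>i\<in>{1..N}. 0 \<le> (\<integral>x. v i x \<partial>(\<rho> i))) \<and>
           (\<forall>i\<in>{1..N}. \<forall>x\<in>topspace (X i). - ((real N - 1) * K) \<le> v i x \<and> v i x \<le> K)"
proof -
  note N = assms(1) and polish = assms(2) and borel = assms(3) and lsc = assms(4)
    and bound = assms(5) and eps = assms(6) and u = assms(7) and dual = assms(8)
    and trans = assms(9)
  have space: "space (\<rho> i) = topspace (X i)" and prob: "prob_space (\<rho> i)"
    and opn: "\<And>U. openin (X i) U \<Longrightarrow> U \<in> sets (\<rho> i)" if "i \<in> {1..N}" for i
    using borel[OF that] by (auto simp: borel_prob_on_def)
  \<comment> \<open>\<open>product_prob_space\<close> asks for a probability measure at every index,
    while \<rho> is unconstrained outside {1..N}; \<open>\<rho> 1\<close> fills the gap.\<close>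
  define M where "M i = (if i \<in> {1..N} then \<rho> i else \<rho> 1)" for i
  have M: "M i = \<rho> i" if "i \<in> {1..N}" for i using that by (simp add: M_def)
  have PiM: "Pi\<^sub>M J M = Pi\<^sub>M J \<rho>" if "J \<subseteq> {1..N}" for J
    using that M by (intro PiM_cong) auto
  have prob_M: "prob_space (M i)" for i using prob N by (auto simp: M_def)
  \<comment> \<open>\<open>K\<close> dominates a supremum taken in [0, \<infinity>].\<close>
  have K: "0 \<le> K"
    using order_trans[OF enn2ereal_nonneg bound[of 1]] N by simp
  have sup: "(SUP z\<in>topspace (X i). \<integral>\<^sup>+ y. c (y(i := z)) \<partial>(Pi\<^sub>M ({1..N} - {i}) \<rho>)) \<le> ennreal K"
    if "i \<in> {1..N}" for i
    using bound[OF that] K by (simp add: less_eq_ennreal.rep_eq enn2ereal_ennreal)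
  have c_meas: "c \<in> borel_measurable (Pi\<^sub>M {1..N} \<rho>)"
  proof (rule borel_measurableI_greater)
    fix a
    have "space (Pi\<^sub>M {1..N} \<rho>) = topspace (product_topology X {1..N})"
      using space by (auto simp: space_PiM topspace_product_topology intro!: PiE_cong)
    then show "{x \<in> space (Pi\<^sub>M {1..N} \<rho>). a < c x} \<in> sets (Pi\<^sub>M {1..N} \<rho>)"
      using lsc polish opn unfolding lower_semicontinuous_map_def
      by (intro openin_product_sets_PiM[where X = X]) auto
  qed
  interpret entropic_dual M "{1..N}" c K \<epsilon>
  proof (intro entropic_dual.intro product_prob_space.intro product_prob_space_axioms.intro
      product_sigma_finite.intro entropic_dual_axioms.intro)
    show "sigma_finite_measure (M i)" for i
      using prob_M[of i] by (simp add: prob_space_imp_sigma_finite)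
    show "(\<integral>\<^sup>+ y. c (y(i := z)) \<partial>(Pi\<^sub>M ({1..N} - {i}) M)) \<le> ennreal K"
      if "i \<in> {1..N}" "z \<in> space (M i)" for i z
      using that sup[OF that(1)] space[OF that(1)]
      by (simp add: PiM M SUP_le_iff)
  qed (use prob_M c_meas K eps PiM in auto)
  have part: "(\<integral>\<^sup>+ x. exp_kernel \<epsilon> (\<Sum>i\<in>{1..N}. v i (x i)) (c x) \<partial>(Pi\<^sub>M {1..N} \<rho>)) = partition_fun v" for v
    by (simp only: partition_fun_def PiM[OF subset_refl])
  have u_int: "integrable (M i) (u i)" if "i \<in> {1..N}" for i
    using u[OF that] that by (simp add: L_exp_def M)
  have NN: "N \<in> {1..N}" "{1..N} - {N} = {1..<N}" using N by auto
  have PiM_N: "Pi\<^sub>M {1..<N} M = Pi\<^sub>M {1..<N} \<rho>" by (intro PiM) auto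
  have "partition_fun u = (\<integral>\<^sup>+ z. ennreal (exp (u N z / \<epsilon>)) * marginal_fun u N z \<partial>(M N))"
    using u_int NN by (intro partition_fun_eq) auto
  also have "\<dots> = (\<integral>\<^sup>+ z. 1 \<partial>(M N))"
  proof (intro nn_integral_cong_AE)
    have "AE z in M N. ereal (u N z) = - ereal \<epsilon> * log_ext (marginal_fun u N z)"
      using trans unfolding M[OF NN(1)] c_eps_transform_def marginal_fun_def NN(2) PiM_N .
    then show "AE z in M N. ennreal (exp (u N z / \<epsilon>)) * marginal_fun u N z = 1"
    proof eventually_elim
      fix z assume z: "ereal (u N z) = - ereal \<epsilon> * log_ext (marginal_fun u N z)"
      \<comment> \<open>The left side is real, while the extended logarithm is infinite at 0 and at
        \<infinity>, so the marginal takes neither value here.\<close>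
      then have F: "marginal_fun u N z \<noteq> 0" "marginal_fun u N z \<noteq> \<infinity>"
        using eps by (auto simp: log_ext_def)
      then have "u N z = transform u N z"
        using z unfolding transform_def by (simp add: log_ext_def)
      with exp_transform[OF F(2,1)]
      have "marginal_fun u N z = ennreal (exp (- u N z / \<epsilon>))" by simp
      then show "ennreal (exp (u N z / \<epsilon>)) * marginal_fun u N z = 1"
        by (simp flip: ennreal_mult' exp_add)
    qed
  qed
  also have "\<dots> = 1" by (simp add: M.emeasure_space_1)
  finally have u_part: "partition_fun u = 1" .
  \<comment> \<open>With partition function 1 the last two terms of the dual functional cancel and
    only the sum of the means remains.\<close>
  have "0 \<le> (\<Sum>i\<in>{1..N}. integral\<^sup>L (M i) (u i))"
    using dual unfolding dual_functional_def part u_part by (simp add: M one_ennreal.rep_eq)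
  then obtain v0 where "admissible v0"
    using admissible_shift[OF _ u_int] u_part N by auto
  from admissible_bounded_above[OF this subset_refl]
  obtain v1 where "admissible v1" "\<forall>j\<in>{1..N}. \<forall>x\<in>space (M j). v1 j x \<le> K" by blast
  from admissible_bounded[OF this(1) _ subset_refl] this(2)
  obtain v where v: "admissible v" "\<forall>j\<in>{1..N}. \<forall>x\<in>space (M j). v j x \<le> K"
    "\<forall>j\<in>{1..N}. \<forall>x\<in>space (M j). - ((real N - 1) * K) \<le> v j x" by auto
  have v_int: "integrable (\<rho> i) (v i)" and v_mean: "0 \<le> (\<integral>x. v i x \<partial>(\<rho> i))"
    if "i \<in> {1..N}" for i
    using v(1) that M[OF that] unfolding admissible_def by metis+
  have v_part: "partition_fun v \<le> 1" using v(1) unfolding admissible_def by blast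
  show ?thesis
  proof (intro exI[of _ v] conjI ballI)
    fix i assume i: "i \<in> {1..N}"
    interpret Mi: prob_space "\<rho> i" using prob[OF i] .
    have "(\<integral>\<^sup>+ x. ennreal (exp (v i x / \<epsilon>)) \<partial>(\<rho> i)) \<le> (\<integral>\<^sup>+ x. ennreal (exp (K / \<epsilon>)) \<partial>(\<rho> i))"
      using v(2) i eps by (intro nn_integral_mono ennreal_leI) (auto simp: M divide_right_mono)
    also have "\<dots> < \<infinity>" by (simp add: Mi.emeasure_space_1)
    finally show "v i \<in> L_exp \<epsilon> (\<rho> i)" using v_int[OF i] by (simp add: L_exp_def)
    show "0 \<le> (\<integral>x. v i x \<partial>(\<rho> i))" using v_mean[OF i] .
    fix x assume "x \<in> topspace (X i)"
    then show "- ((real N - 1) * K) \<le> v i x" "v i x \<le> K"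
      using v(2,3) i space[OF i] by (auto simp: M)
  next
    \<comment> \<open>Being at most 1, the partition function is a real \<open>p\<close>, so the
      extended arithmetic becomes real and \<open>\<epsilon> - \<epsilon> * p\<close> is
      nonnegative.\<close>
    obtain p where p: "partition_fun v = ennreal p" "0 \<le> p" "p \<le> 1"
      using v_part by (cases "partition_fun v") (auto simp: top_unique)
    have "0 \<le> (\<Sum>i\<in>{1..N}. (\<integral>x. v i x \<partial>(\<rho> i)))" using v_mean by (rule sum_nonneg)
    moreover have "\<epsilon> * p \<le> \<epsilon>" using eps p by (simp add: mult_left_le)
    ultimately show "0 \<le> dual_functional N \<rho> c \<epsilon> v"
      unfolding dual_functional_def part p(1) using p(2) by (simp add: enn2ereal_ennreal)
  qed
qed

end
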